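(* Let $M\subset E^{n}$ be a strong $r$-helix submanifold of dimension $n-k$ with space of helix directions $H(M)\subset E^{n}$. Let $N_j\in\vartheta(M)$ be the normal component of a direction $d_j\in H(M)$, and let $\alpha : I\to M$ be a line of curvature with respect to $N_j$, with unit tangent vector field $T$. If $N_j'\in\varkappa(M)$ along $\alpha$ (that is, the derivative $N_j'=\overline{D}_TN_j$ of $N_j$ along $\alpha$ is tangent to $M$), then $d_j\in \operatorname{Sp}\{T\}^{\perp}$ along $\alpha$, i.e. $\langle d_j,T\rangle=0$ at every point of $\alpha$.
   Context: $E^{n}=\mathbb{R}^{n}$ is Euclidean $n$-space with its standard inner product; manifolds, curves and fields are $C^\infty$. $\overline{D}$ is the standard covariant derivative (Riemannian connection) on $E^{n}$. $\vartheta(M)$ denotes the normal vector fields (normal space) of $M$ and $\varkappa(M)$ the space of tangent vector fields on $M$. $\operatorname{Sp}\{T\}^{\perp}$ is the orthogonal complement of the span of $T$. Helix directions: let $M\subset \mathbb{R}^{n}$ be a submanifold. A unit vector $d\in\mathbb{R}^{n}$ is a helix direction of $M$ if the angle between $d$ and the tangent space $T_pM$ is constant (independent of $p\in M$). $H(M)$ denotes the set of helix directions of $M$; when it is regarded as a linear space, it consists of all scalar multiples of helix directions, and a "direction $d\in H(M)$" means a unit vector in it. $M$ is a strong $r$-helix submanifold if $H(M)$ is a linear subspace of $\mathbb{R}^{n}$ of dimension greater than or equal to $r$. Components of a direction: for a direction $d_j\in H(M)$, one decomposes $d_j=\cos(\theta_j)\,N_j+\sin(\theta_j)\,T_j$ along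 $M$, with $\theta_j$ constant, $N_j$ a unit normal vector field of $M$ and $T_j$ a unit tangent vector field of $M$; $N_j$ and $T_j$ are called the normal and tangent components of $d_j$. Line of curvature with respect to a normal field: for a normal vector field $N$, the shape operator is $A_N(X)=\operatorname{tang}(-\overline{D}_XN)$, the tangential component of $-\overline{D}_XN$. A curve $\alpha$ in $M$ with tangent $T$ is a line of curvature with respect to $N$ if $A_N(T)=\lambda T$ along $\alpha$, where $\lambda$ is a principal curvature (an eigenvalue of $A_N$, a function along $\alpha$).
   Formalization: Added: the principal curvature λ of the line of curvature is nonzero on a dense subset of I (I an open interval). Without this the claim fails: a line in a plane of E³ along the tangent component of an oblique d has λ=0 and N'=0, but ⟨d,T⟩≠0. *)

theory Defs
  imports "HOL-Analysis.Analysis"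
begin

text \<open>
  \<open>Ck_on k f S\<close>: \<open>f\<close> is of class \<open>C\<^sup>k\<close> on \<open>S\<close>, expressed through iterated directional
  derivatives. Only meaningful for open \<open>S\<close>.
\<close>

primrec Ck_on ::
  "nat \<Rightarrow> ('a::euclidean_space \<Rightarrow> 'b::euclidean_space) \<Rightarrow> 'a set \<Rightarrow> bool" where
  "Ck_on 0 f S \<longleftrightarrow> continuous_on S f"
| "Ck_on (Suc k) f S \<longleftrightarrow>
     (\<forall>x\<in>S. f differentiable (at x)) \<and>
     (\<forall>v. Ck_on k (\<lambda>x. frechet_derivative f (at x) v) S)"

definition smooth_on :: "'a set \<Rightarrow> ('a::euclidean_space \<Rightarrow> 'b::euclidean_space) \<Rightarrow> bool" where
  "smooth_on S f \<longleftrightarrow> (\<forall>k. Ck_on k f S)"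

text \<open>
  Embedded submanifolds of Euclidean space, by slice charts: near each of its points, \<open>M\<close> is
  carried by a diffeomorphism between open sets of the ambient space onto an open piece of an
  \<open>m\<close>-dimensional linear subspace \<open>L\<close>.
\<close>

definition submanifold :: "nat \<Rightarrow> (real ^ 'n) set \<Rightarrow> bool" where
  "submanifold m M \<longleftrightarrow>
     (\<forall>p\<in>M. \<exists>U V L. \<exists>\<phi> \<psi> :: real ^ 'n \<Rightarrow> real ^ 'n. open U \<and> p \<in> U \<and> open V \<and>
        homeomorphism U V \<phi> \<psi> \<and> smooth_on U \<phi> \<and> smooth_on V \<psi> \<and>
        subspace L \<and> dim L = m \<and> \<phi> ` (U \<inter> M) = V \<inter> L)"

definition tangent_space :: "(real ^ 'n) set \<Rightarrow> real ^ 'n \<Rightarrow> (real ^ 'n) set" where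
  "tangent_space M p =
     {v. \<exists>\<epsilon>>0. \<exists>\<gamma> :: real \<Rightarrow> real ^ 'n. smooth_on {-\<epsilon><..<\<epsilon>} \<gamma> \<and> \<gamma> ` {-\<epsilon><..<\<epsilon>} \<subseteq> M \<and>
        \<gamma> 0 = p \<and> (\<gamma> has_vector_derivative v) (at 0)}"

definition normal_space :: "(real ^ 'n) set \<Rightarrow> real ^ 'n \<Rightarrow> (real ^ 'n) set" where
  "normal_space M p = (tangent_space M p)\<^sup>\<bottom>"

text \<open>Smoothness on a submanifold: locally the restriction of a smooth map of the ambient space.\<close>

definition smooth_field :: "(real ^ 'n) set \<Rightarrow> (real ^ 'n \<Rightarrow> real ^ 'n) \<Rightarrow> bool" where
  "smooth_field M X \<longleftrightarrow>
     (\<forall>p\<in>M. \<exists>U Y. open U \<and> p \<in> U \<and> smooth_on U Y \<and> (\<forall>q\<in>U \<inter> M. Y q = X q))"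

definition tangent_fields :: "(real ^ 'n) set \<Rightarrow> (real ^ 'n \<Rightarrow> real ^ 'n) set" where
  "tangent_fields M = {X. smooth_field M X \<and> (\<forall>p\<in>M. X p \<in> tangent_space M p)}"

definition normal_fields :: "(real ^ 'n) set \<Rightarrow> (real ^ 'n \<Rightarrow> real ^ 'n) set" where
  "normal_fields M = {X. smooth_field M X \<and> (\<forall>p\<in>M. X p \<in> normal_space M p)}"

definition orth_proj :: "(real ^ 'n) set \<Rightarrow> real ^ 'n \<Rightarrow> real ^ 'n" where
  "orth_proj W v = (THE u. u \<in> W \<and> v - u \<in> W\<^sup>\<bottom>)"

text \<open>
  The angle in \<open>[0, \<pi>/2]\<close> between a nonzero vector and a linear subspace, i.e. the angle between
  the vector and its orthogonal projection; it is \<open>\<pi>/2\<close> if that projection vanishes.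
\<close>

definition angle_subspace :: "real ^ 'n \<Rightarrow> (real ^ 'n) set \<Rightarrow> real" where
  "angle_subspace d W = arccos (norm (orth_proj W d) / norm d)"

definition helix_direction :: "(real ^ 'n) set \<Rightarrow> real ^ 'n \<Rightarrow> bool" where
  "helix_direction M d \<longleftrightarrow>
     norm d = 1 \<and> (\<exists>\<theta>. \<forall>p\<in>M. angle_subspace d (tangent_space M p) = \<theta>)"

definition helix_space :: "(real ^ 'n) set \<Rightarrow> (real ^ 'n) set" where
  "helix_space M = {c *\<^sub>R d | c d. helix_direction M d}"

definition strong_helix_submanifold :: "nat \<Rightarrow> nat \<Rightarrow> (real ^ 'n) set \<Rightarrow> bool" where
  "strong_helix_submanifold r m M \<longleftrightarrow>
     submanifold m M \<and> subspace (helix_space M) \<and> r \<le> dim (helix_space M)"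

text \<open>\<open>N\<close> and \<open>X\<close> are the normal and tangent components of \<open>d\<close> along \<open>M\<close>, with angle \<open>\<theta>\<close>.\<close>

definition direction_components ::
  "(real ^ 'n) set \<Rightarrow> real ^ 'n \<Rightarrow> real \<Rightarrow> (real ^ 'n \<Rightarrow> real ^ 'n) \<Rightarrow> (real ^ 'n \<Rightarrow> real ^ 'n) \<Rightarrow> bool"
  where
  "direction_components M d \<theta> N X \<longleftrightarrow>
     N \<in> normal_fields M \<and> (\<forall>p\<in>M. norm (N p) = 1) \<and>
     X \<in> tangent_fields M \<and> (\<forall>p\<in>M. norm (X p) = 1) \<and>
     (\<forall>p\<in>M. d = cos \<theta> *\<^sub>R N p + sin \<theta> *\<^sub>R X p)"

text \<open>
  The Euclidean derivative of a field along \<open>M\<close> at \<open>p\<close> in the direction \<open>v\<close>. Derivatives within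
  \<open>M\<close> are not unique as linear maps on the ambient space, but all of them agree on tangent vectors
  of \<open>M\<close>; so for a smooth field and \<open>v \<in> tangent_space M p\<close> this is the derivative of the field
  along any curve in \<open>M\<close> through \<open>p\<close> with velocity \<open>v\<close>.
\<close>

definition covariant_deriv ::
  "(real ^ 'n) set \<Rightarrow> (real ^ 'n \<Rightarrow> real ^ 'n) \<Rightarrow> real ^ 'n \<Rightarrow> real ^ 'n \<Rightarrow> real ^ 'n" where
  "covariant_deriv M N p v = frechet_derivative N (at p within M) v"

definition shape_operator ::
  "(real ^ 'n) set \<Rightarrow> (real ^ 'n \<Rightarrow> real ^ 'n) \<Rightarrow> real ^ 'n \<Rightarrow> real ^ 'n \<Rightarrow> real ^ 'n" where
  "shape_operator M N p v = orth_proj (tangent_space M p) (- covariant_deriv M N p v)"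

definition regular_curve :: "(real ^ 'n) set \<Rightarrow> real set \<Rightarrow> (real \<Rightarrow> real ^ 'n) \<Rightarrow> bool" where
  "regular_curve M I \<alpha> \<longleftrightarrow>
     open I \<and> is_interval I \<and> smooth_on I \<alpha> \<and> \<alpha> ` I \<subseteq> M \<and>
     (\<forall>t\<in>I. vector_derivative \<alpha> (at t) \<noteq> 0)"

definition unit_tangent :: "(real \<Rightarrow> real ^ 'n) \<Rightarrow> real \<Rightarrow> real ^ 'n" where
  "unit_tangent \<alpha> t = sgn (vector_derivative \<alpha> (at t))"

text \<open>
  \<open>\<kappa>\<close> is the principal curvature function along the curve. It is an eigenvalue of the shape
  operator because the unit tangent of a regular curve is nonzero; the value 0 is allowed.
\<close>

definition line_of_curvature ::
  "(real ^ 'n) set \<Rightarrow> (real ^ 'n \<Rightarrow> real ^ 'n) \<Rightarrow> real set \<Rightarrow> (real \<Rightarrow> real ^ 'n) \<Rightarrow> (real \<Rightarrow> real) \<Rightarrow> bool"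
  where
  "line_of_curvature M N I \<alpha> \<kappa> \<longleftrightarrow>
     regular_curve M I \<alpha> \<and>
     (\<forall>t\<in>I. shape_operator M N (\<alpha> t) (unit_tangent \<alpha> t) = \<kappa> t *\<^sub>R unit_tangent \<alpha> t)"

end

theory Submission
  imports Defs
begin

text \<open>
  The inner product \<open>N \<bullet> d\<close> is the constant \<open>cos \<theta>\<close> on \<open>M\<close>, because \<open>N\<close> is a unit normal field
  and the rest of \<open>d\<close> is tangent. Differentiating this identity along \<open>\<alpha>\<close> gives
  \<open>D\<^sub>T N \<bullet> d = 0\<close> (lemma \<open>covariant_deriv_orthogonal\<close>). Since \<open>D\<^sub>T N\<close> is tangent to \<open>M\<close>, the
  tangential projection in the shape operator does nothing, so that the line-of-curvature
  equation reads \<open>- D\<^sub>T N = \<kappa> T\<close>. Hence \<open>\<kappa> (T \<bullet> d) = 0\<close>, and \<open>T \<bullet> d\<close> vanishes wherever \<open>\<kappa>\<close>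
  does not. Those parameters are dense, and \<open>\<alpha>' \<bullet> d\<close> is continuous, so it vanishes everywhere.

  The vector being projected is \<open>- D\<^sub>T N\<close>, whereas it is \<open>D\<^sub>T N\<close> that is known to be tangent; the
  sign is dealt with by reversing the parameter of a curve that represents the tangent vector
  (lemma \<open>tangent_space_uminus\<close>).
\<close>

lemma Ck_on_cong:
  assumes "open S" "\<And>x. x \<in> S \<Longrightarrow> f x = g x" "Ck_on k f S"
  shows "Ck_on k g S"
  using assms(2,3)
proof (induction k arbitrary: f g)
  case 0
  then show ?case by (simp cong: continuous_on_cong)
next
  case (Suc k)
  have D: "(g has_derivative frechet_derivative f (at x)) (at x)" if "x \<in> S" for x
    by (rule has_derivative_transform_within_open[where s = S and f = f])
      (use Suc.prems \<open>open S\<close> that in \<open>auto simp: frechet_derivative_works[symmetric]\<close>)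
  then have eq: "frechet_derivative f (at x) = frechet_derivative g (at x)" if "x \<in> S" for x
    using frechet_derivative_at that by blast
  have "Ck_on k (\<lambda>x. frechet_derivative g (at x) v) S" for v
    by (rule Suc.IH[where f = "\<lambda>x. frechet_derivative f (at x) v"]) (use Suc.prems eq in auto)
  with D show ?case
    by (auto simp: differentiable_def)
qed

text \<open>
  This makes the reversal of a smooth curve smooth. The sign that the chain rule produces is
  moved into the direction of differentiation: the derivative of \<open>\<lambda>x. f (- x)\<close> in direction \<open>v\<close> is
  the reflection of the derivative of \<open>f\<close> in direction \<open>- v\<close>, so the induction hypothesis applies
  to the latter.
\<close>

lemma Ck_on_reflect:
  assumes "open S" "Ck_on k f S" "uminus ` S = S"
  shows "Ck_on k (\<lambda>x. f (- x)) S"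
  using assms(2)
proof (induction k arbitrary: f)
  case 0
  have "continuous_on S (f \<circ> uminus)"
    using 0 assms(3) by (intro continuous_on_compose continuous_intros) auto
  then show ?case by (simp add: o_def)
next
  case (Suc k)
  have D: "((\<lambda>x. f (- x)) has_derivative (\<lambda>v. frechet_derivative f (at (- x)) (- v))) (at x)"
    if "x \<in> S" for x
  proof -
    have "- x \<in> S" using that assms(3) by blast
    then have "(f has_derivative frechet_derivative f (at (- x))) (at (- x))"
      using Suc.prems by (auto simp: frechet_derivative_works[symmetric])
    then show ?thesis
      by (rule has_derivative_compose[rotated]) (auto intro!: derivative_eq_intros)
  qed
  then have eq: "frechet_derivative f (at (- x)) (- v) = frechet_derivative (\<lambda>x. f (- x)) (at x) v"
    if "x \<in> S" for x v
    using frechet_derivative_at that by metis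
  have "Ck_on k (\<lambda>x. frechet_derivative (\<lambda>x. f (- x)) (at x) v) S" for v
  proof (rule Ck_on_cong[OF \<open>open S\<close>])
    show "Ck_on k (\<lambda>x. frechet_derivative f (at (- x)) (- v)) S"
      using Suc.prems by (intro Suc.IH[where f = "\<lambda>x. frechet_derivative f (at x) (- v)"]) auto
  qed (rule eq)
  with D show ?case
    by (auto simp: differentiable_def)
qed

lemma tangent_space_uminus:
  assumes "v \<in> tangent_space M p"
  shows "- v \<in> tangent_space M p"
proof -
  obtain \<epsilon> \<gamma> where e: "\<epsilon> > 0" "smooth_on {-\<epsilon><..<\<epsilon>} \<gamma>" "\<gamma> ` {-\<epsilon><..<\<epsilon>} \<subseteq> M" "\<gamma> 0 = p"
    "(\<gamma> has_vector_derivative v) (at 0)"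
    using assms unfolding tangent_space_def by blast
  have sym: "uminus ` {-\<epsilon><..<\<epsilon>} = {-\<epsilon><..<\<epsilon>}"
    by simp
  have "smooth_on {-\<epsilon><..<\<epsilon>} (\<lambda>t. \<gamma> (- t))"
    using e(2) Ck_on_reflect[OF open_greaterThanLessThan _ sym] unfolding smooth_on_def by blast
  moreover have "(\<lambda>t. \<gamma> (- t)) ` {-\<epsilon><..<\<epsilon>} \<subseteq> M"
    using e(3) sym by auto
  moreover have "((\<lambda>t. \<gamma> (- t)) has_vector_derivative - v) (at 0)"
  proof -
    have "(uminus has_vector_derivative (- 1 :: real)) (at (0 :: real))"
      by (auto intro!: derivative_eq_intros simp: has_vector_derivative_def)
    then have "(\<gamma> \<circ> uminus has_vector_derivative - 1 *\<^sub>R v) (at 0)"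
      by (rule vector_diff_chain_at) (use e(5) in simp)
    then show ?thesis by (simp add: o_def)
  qed
  ultimately show ?thesis
    unfolding tangent_space_def using e(1,4)
    by (intro CollectI exI[of _ \<epsilon>] conjI exI[of _ "\<lambda>t. \<gamma> (- t)"]) auto
qed

text \<open>
  If \<open>u\<close> is another candidate for the projection of \<open>v\<close>, then \<open>v - u\<close> is orthogonal to both \<open>u\<close>
  and \<open>v\<close>, hence to itself.
\<close>

lemma orth_proj_eq_self:
  assumes "v \<in> W"
  shows "orth_proj W v = v"
  unfolding orth_proj_def
proof (rule the_equality)
  show "v \<in> W \<and> v - v \<in> W\<^sup>\<bottom>"
    using assms by (simp add: orthogonal_comp_def orthogonal_def)
next
  fix u assume u: "u \<in> W \<and> v - u \<in> W\<^sup>\<bottom>"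
  then have "v \<bullet> (v - u) = 0" "u \<bullet> (v - u) = 0"
    using assms by (auto simp: orthogonal_comp_def orthogonal_def)
  then have "(v - u) \<bullet> (v - u) = 0"
    by (simp add: inner_diff_left)
  then show "u = v" by simp
qed

lemma smooth_on_imp_differentiable:
  "smooth_on S f \<Longrightarrow> x \<in> S \<Longrightarrow> f differentiable (at x)"
  unfolding smooth_on_def by (drule spec[of _ "Suc 0"]) simp

lemma smooth_field_differentiable:
  assumes "smooth_field M N" "p \<in> M"
  shows "N differentiable (at p within M)"
proof -
  obtain U Y where U: "open U" "p \<in> U" "smooth_on U Y" "\<And>q. q \<in> U \<inter> M \<Longrightarrow> Y q = N q"
    using assms(1)[unfolded smooth_field_def, THEN bspec, OF assms(2)] by auto
  have "Y differentiable (at p within M)"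
    using differentiable_at_withinI[OF smooth_on_imp_differentiable[OF U(3,2)]] .
  then obtain Y' where "(Y has_derivative Y') (at p within M)"
    unfolding differentiable_def by blast
  moreover obtain e where "e > 0" "ball p e \<subseteq> U"
    using U(1,2) by (rule openE)
  ultimately have "(N has_derivative Y') (at p within M)"
    by (elim has_derivative_transform_within)
      (use U(4) assms(2) in \<open>auto simp: dist_commute subset_eq\<close>)
  then show ?thesis by (auto simp: differentiable_def)
qed

text \<open>
  A derivative of \<open>N\<close> within \<open>M\<close> is in general not determined by \<open>N\<close>, but the chain rule along a
  curve in \<open>M\<close> holds for each of them, in particular for the one chosen by \<open>covariant_deriv\<close>.
\<close>

lemma covariant_deriv_along_curve:
  assumes "smooth_field M N" "open I" "t \<in> I" "\<alpha> ` I \<subseteq> M"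
    and "(\<alpha> has_vector_derivative v) (at t)"
  shows "((\<lambda>s. N (\<alpha> s)) has_vector_derivative covariant_deriv M N (\<alpha> t) v) (at t)"
proof -
  have "(N has_derivative covariant_deriv M N (\<alpha> t)) (at (\<alpha> t) within M)"
    using smooth_field_differentiable[of M N "\<alpha> t"] assms(1,3,4)
    unfolding covariant_deriv_def by (auto simp: frechet_derivative_works)
  then have "(N has_derivative covariant_deriv M N (\<alpha> t)) (at (\<alpha> t) within \<alpha> ` I)"
    using assms(4) by (rule has_derivative_subset)
  moreover have "(\<alpha> has_vector_derivative v) (at t within I)"
    using assms(5) by (rule has_vector_derivative_at_within)
  ultimately have "((N \<circ> \<alpha>) has_vector_derivative covariant_deriv M N (\<alpha> t) v) (at t within I)"
    using vector_derivative_diff_chain_within by blast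
  then show ?thesis
    using at_within_open[OF assms(3,2)] by (simp add: o_def)
qed

lemma linear_covariant_deriv:
  assumes "smooth_field M N" "p \<in> M"
  shows "linear (covariant_deriv M N p)"
  unfolding covariant_deriv_def
  using linear_frechet_derivative[OF smooth_field_differentiable[OF assms]] .

lemma direction_components_inner:
  assumes "direction_components M d \<theta> N X" "p \<in> M"
  shows "N p \<bullet> d = cos \<theta>"
proof -
  have dec: "d = cos \<theta> *\<^sub>R N p + sin \<theta> *\<^sub>R X p" and "norm (N p) = 1"
    using assms unfolding direction_components_def by auto
  moreover have "N p \<bullet> X p = 0"
    using assms unfolding direction_components_def normal_fields_def tangent_fields_def
      normal_space_def orthogonal_comp_def orthogonal_def
    by (simp add: inner_commute[of "N p"])
  ultimately show ?thesis
    by (subst dec) (simp add: inner_add_right dot_square_norm)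
qed

text \<open>This is the derivative of the constant function \<open>N \<bullet> d\<close> along the curve.\<close>

lemma covariant_deriv_orthogonal:
  assumes "direction_components M d \<theta> N X" "open I" "t \<in> I" "\<alpha> ` I \<subseteq> M"
    and "(\<alpha> has_vector_derivative v) (at t)"
  shows "covariant_deriv M N (\<alpha> t) v \<bullet> d = 0"
proof -
  have "smooth_field M N"
    using assms(1) by (auto simp: direction_components_def normal_fields_def)
  then have "((\<lambda>s. N (\<alpha> s) \<bullet> d) has_vector_derivative covariant_deriv M N (\<alpha> t) v \<bullet> d) (at t)"
    using covariant_deriv_along_curve[OF _ assms(2-5)]
    by (intro bounded_linear.has_vector_derivative[OF bounded_linear_inner_left]) auto
  moreover have "((\<lambda>s. N (\<alpha> s) \<bullet> d) has_vector_derivative 0) (at t)"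
  proof (rule has_vector_derivative_transform_within_open[OF _ assms(2,3)])
    show "((\<lambda>_. cos \<theta>) has_vector_derivative 0) (at t)" by simp
    show "cos \<theta> = N (\<alpha> s) \<bullet> d" if "s \<in> I" for s
      using direction_components_inner[OF assms(1)] that assms(4) by (auto simp: image_subset_iff)
  qed
  ultimately show ?thesis
    by (rule vector_derivative_unique_at)
qed

lemma smooth_on_continuous_vector_derivative:
  assumes "smooth_on I \<alpha>"
  shows "continuous_on I (\<lambda>t. vector_derivative \<alpha> (at t))"
proof -
  have "continuous_on I (\<lambda>t. frechet_derivative \<alpha> (at t) 1)"
    using assms[unfolded smooth_on_def, THEN spec, of "Suc 0"] by simp
  moreover have "frechet_derivative \<alpha> (at t) 1 = vector_derivative \<alpha> (at t)" if "t \<in> I" for t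
  proof -
    have "(\<alpha> has_derivative (\<lambda>s. s *\<^sub>R vector_derivative \<alpha> (at t))) (at t)"
      using smooth_on_imp_differentiable[OF assms that]
      unfolding vector_derivative_works has_vector_derivative_def .
    then show ?thesis
      by (simp flip: frechet_derivative_at)
  qed
  ultimately show ?thesis
    by (simp cong: continuous_on_cong)
qed

theorem theorem3p4:
  fixes M :: "(real ^ 'n) set"
    and r k :: nat
    and d :: "real ^ 'n"
    and \<theta> :: real
    and N X :: "real ^ 'n \<Rightarrow> real ^ 'n"
    and I :: "real set"
    and \<alpha> :: "real \<Rightarrow> real ^ 'n"
    and \<kappa> :: "real \<Rightarrow> real"
  assumes "k \<le> CARD('n)"
    and "strong_helix_submanifold r (CARD('n) - k) M"
    and "d \<in> helix_space M" and "norm d = 1"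
    and "direction_components M d \<theta> N X"
    and "line_of_curvature M N I \<alpha> \<kappa>"
    and nondegenerate: "I \<subseteq> closure {t \<in> I. \<kappa> t \<noteq> 0}"
    and "\<forall>t\<in>I. covariant_deriv M N (\<alpha> t) (unit_tangent \<alpha> t) \<in> tangent_space M (\<alpha> t)"
  shows "\<forall>t\<in>I. d \<in> (span {unit_tangent \<alpha> t})\<^sup>\<bottom>"
proof -
  let ?v = "\<lambda>t. vector_derivative \<alpha> (at t)"
  let ?T = "unit_tangent \<alpha>"
  let ?D = "\<lambda>t. covariant_deriv M N (\<alpha> t)"
  have I: "open I" "smooth_on I \<alpha>" "\<alpha> ` I \<subseteq> M" "\<And>t. t \<in> I \<Longrightarrow> ?v t \<noteq> 0"
    and curv: "\<And>t. t \<in> I \<Longrightarrow> shape_operator M N (\<alpha> t) (?T t) = \<kappa> t *\<^sub>R ?T t"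
    using assms(6) unfolding line_of_curvature_def regular_curve_def by auto
  have smN: "smooth_field M N"
    using assms(5) by (auto simp: direction_components_def normal_fields_def)
  have curved: "?v t \<bullet> d = 0" if t: "t \<in> I" and "\<kappa> t \<noteq> 0" for t
  proof -
    have "(\<alpha> has_vector_derivative ?v t) (at t)"
      using smooth_on_imp_differentiable[OF I(2) t] vector_derivative_works by blast
    then have "?D t (?v t) \<bullet> d = 0"
      by (rule covariant_deriv_orthogonal[OF assms(5) I(1) t I(3)])
    moreover have "linear (?D t)"
      using linear_covariant_deriv[OF smN] I(3) t by blast
    ultimately have "?D t (?T t) \<bullet> d = 0"
      by (simp add: unit_tangent_def sgn_div_norm linear_cmul)
    moreover have "- ?D t (?T t) = \<kappa> t *\<^sub>R ?T t"
      using curv[OF t] assms(8) t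
      by (simp add: shape_operator_def orth_proj_eq_self tangent_space_uminus)
    ultimately have "(\<kappa> t *\<^sub>R ?T t) \<bullet> d = 0"
      by (metis inner_minus_left neg_0_equal_iff_equal)
    then show ?thesis
      using \<open>\<kappa> t \<noteq> 0\<close> I(4)[OF t] by (simp add: unit_tangent_def sgn_div_norm)
  qed
  \<comment> \<open>At the zeros of \<open>\<kappa>\<close> the equation \<open>\<kappa> (T \<bullet> d) = 0\<close> says nothing; they are reached as limits.\<close>
  have "continuous_on I (\<lambda>t. ?v t \<bullet> d)"
    using smooth_on_continuous_vector_derivative[OF I(2)] by (intro continuous_intros)
  then have "closedin (top_of_set I) {t \<in> I. ?v t \<bullet> d = 0}"
    by (rule continuous_closedin_preimage_constant)
  then obtain C where C: "closed C" "{t \<in> I. ?v t \<bullet> d = 0} = I \<inter> C"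
    unfolding closedin_closed by blast
  have "closure {t \<in> I. \<kappa> t \<noteq> 0} \<subseteq> C"
    using C curved by (intro closure_minimal) auto
  with nondegenerate C(2) have "?v t \<bullet> d = 0" if "t \<in> I" for t
    using that by blast
  then show ?thesis
    by (auto simp: orthogonal_comp_def orthogonal_def span_singleton unit_tangent_def sgn_div_norm)
qed

end
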